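(* The semi-implicit scheme (S) described in the context is energy stable, in the following sense: if $c^{l}=(c^{1,l},\dots,c^{M,l})$ with $c^{m,l}\in\mathcal{C}_{\mathrm{per}}$, $c^{m,l}>0$ at every grid point and $\overline{\rho_h^f}+\sum_{m=1}^Mz^m\overline{c^{m,l}}=0$, and $c^{l+1}=(c^{1,l+1},\dots,c^{M,l+1})$ is the positive solution of (S) at the next time level, then, for any time step $\Delta t>0$, $$F_h(c^{l+1})\le F_h(c^{l}),$$ where $F_h$ is the discrete free energy $$F_h[c]=\frac12\left\|\sum_{m=1}^Mz^mc^{m}+\rho_h^f\right\|^2_{\mathcal{L}_\kappa^{-1}}+\sum_{m=1}^M\left\langle c^{m},\log(vc^{m})-1\right\rangle_\Omega+\frac12\sum_{n=1}^M\sum_{m=1}^Mg^{mn}\langle c^{m},c^{n}\rangle_\Omega+\sum_{m=1}^M\frac{\sigma^m}{2}\|\nabla_hc^{m}\|_2^2 .$$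
   Context: Grid and periodic functions. $\Omega=[a,b]^3$, $N$ is a positive integer, $h=(b-a)/N$, and grid points are $x_i=a+(i-\frac12)h$, $y_j=a+(j-\frac12)h$, $z_k=a+(k-\frac12)h$. $\mathcal{C}_{\mathrm{per}}$ is the space of real grid functions $v=(v_{i,j,k})_{i,j,k\in\mathbb{Z}}$ that are $N$-periodic in each index: $v_{i,j,k}=v_{i+\alpha N,j+\beta N,k+\gamma N}$ for all integers $\alpha,\beta,\gamma$. The average of $v$ is $\overline{v}=\frac{h^3}{|\Omega|}\sum_{i,j,k=1}^N v_{i,j,k}$, and $\mathring{\mathcal{C}}_{\mathrm{per}}=\{v\in\mathcal{C}_{\mathrm{per}}:\overline v=0\}$. Face-centered periodic functions in the $x$-direction have values $f_{i+\frac12,j,k}$ and are $N$-periodic in each index; similarly in the $y$- and $z$-directions. Difference operators. $D_xv_{i+\frac12,j,k}=\frac1h(v_{i+1,j,k}-v_{i,j,k})$, $A_xv_{i+\frac12,j,k}=\frac12(v_{i+1,j,k}+v_{i,j,k})$, and for face functions $d_xf_{i,j,k}=\frac1h(f_{i+\frac12,j,k}-f_{i-\frac12,j,k})$; $D_y,D_z,A_y,A_z,d_y,d_z$ are analogous. $\nabla_hv=(D_xv,D_yv,D_zv)$. For $v\in\mathcal{C}_{\mathrm{per}}$ and a periodic coefficient $\mathcal{D}$ given at the face points, $\nabla_h\cdot(\mathcal{D}\nabla_hv)_{i,j,k}=d_x(\mathcal{D}D_xv)_{i,j,k}+d_y(\mathcal{D}D_yv)_{i,j,k}+d_z(\mathcal{D}D_zv)_{i,j,k}$,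 and $\Delta_h v=\nabla_h\cdot(\nabla_h v)$ (the case $\mathcal{D}\equiv1$). Inner products and norms. $\langle\nu,\xi\rangle_\Omega=h^3\sum_{i,j,k=1}^N\nu_{i,j,k}\xi_{i,j,k}$. $\|\nabla_hv\|_2^2=\|D_xv\|_2^2+\|D_yv\|_2^2+\|D_zv\|_2^2$, where $\|f\|_2^2$ for a periodic face function is $h^3$ times the sum of $|f|^2$ over one period of faces. For a positive periodic coefficient $\mathcal{D}$ and $\phi\in\mathring{\mathcal{C}}_{\mathrm{per}}$, $\mathcal{L}_{\mathcal{D}}^{-1}\phi$ denotes the unique $\varphi\in\mathring{\mathcal{C}}_{\mathrm{per}}$ with $\mathcal{L}_{\mathcal{D}}\varphi:=-\nabla_h\cdot(\mathcal{D}\nabla_h\varphi)=\phi$, and $\|\phi\|^2_{\mathcal{L}_{\mathcal{D}}^{-1}}=\langle\phi,\mathcal{L}_{\mathcal{D}}^{-1}\phi\rangle_\Omega$ (equivalently, $h^3$ times the sum over one period of all faces of $\mathcal{D}$ times the squared components of $\nabla_h\varphi$). Parameters. $M\ge1$ is the number of ionic species; $z^m\in\mathbb{R}$ are valences; $\epsilon^m>0$; $\sigma^m>0$ are gradient energy coefficients; $v>0$ is a constant; $\kappa$ is a periodic coefficient function with $\kappa\ge\kappa_0>0$; $G=(g^{mn})$ is a symmetric $M\times M$ matrix with non-negative entries, and $G=G_c-G_e$ where $G_c=(g_c^{mn})$ and $G_e=(g_e^{mn})$ are positive semi-definite (symmetric) matrices; $\rho_h^f\in\mathcal{C}_{\mathrm{per}}$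 is the fixed charge density. Scheme (S). Given $c^{m,l}\in\mathcal{C}_{\mathrm{per}}$, $m=1,\dots,M$, find positive $c^{m,l+1}\in\mathcal{C}_{\mathrm{per}}$, together with $\mu^{m,l+1},\psi^{l+1}\in\mathcal{C}_{\mathrm{per}}$, such that for $m=1,\dots,M$ $$\frac{c^{m,l+1}-c^{m,l}}{\Delta t}=\epsilon^m\nabla_h\cdot\left(\check c^{m,l}\nabla_h\mu^{m,l+1}\right),$$ $$\mu^{m,l+1}=z^m\psi^{l+1}+\log c^{m,l+1}+\sum_{n=1}^Mg_c^{mn}c^{n,l+1}-\sigma^m\Delta_hc^{m,l+1}-\sum_{n=1}^Mg_e^{mn}c^{n,l},$$ $$-\nabla_h\cdot(\kappa\nabla_h\psi^{l+1})=\sum_{m=1}^Mz^mc^{m,l+1}+\rho_h^f,$$ where the mobilities at face points are $\check c^{m,l}_{i+\frac12,j,k}=A_xc^{m,l}_{i+\frac12,j,k}$, $\check c^{m,l}_{i,j+\frac12,k}=A_yc^{m,l}_{i,j+\frac12,k}$, $\check c^{m,l}_{i,j,k+\frac12}=A_zc^{m,l}_{i,j,k+\frac12}$. The potential is normalized by $\overline{\psi^{l+1}}=0$ (it is otherwise determined only up to an additive constant, which does not affect the equations for $c^{m,l+1}$). *)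

theory Defs
  imports "HOL-Analysis.Analysis"
begin

text \<open>
  A grid function \<open>v\<close> has \<open>v i j k\<close> as its value at the cell centre
  \<open>(a + (i - 1/2) h, a + (j - 1/2) h, a + (k - 1/2) h)\<close>.
  A face function is a triple \<open>(f, g, q)\<close> of functions on the x-, y- and z-faces, stored
  with the half-integer index rounded down: \<open>f i j k\<close>, \<open>g i j k\<close>, \<open>q i j k\<close> are the values at
  \<open>(i + 1/2, j, k)\<close>, \<open>(i, j + 1/2, k)\<close>, \<open>(i, j, k + 1/2)\<close>.
\<close>

type_synonym gridfun = "int \<Rightarrow> int \<Rightarrow> int \<Rightarrow> real"
type_synonym facefun = "gridfun \<times> gridfun \<times> gridfun"

definition mesh :: "real \<Rightarrow> real \<Rightarrow> nat \<Rightarrow> real" where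
  "mesh a b N = (b - a) / real N"

definition cper :: "nat \<Rightarrow> gridfun set" where
  "cper N = {v. \<forall>i j k \<alpha> \<beta> \<gamma>.
     v i j k = v (i + \<alpha> * int N) (j + \<beta> * int N) (k + \<gamma> * int N)}"

definition face_per :: "nat \<Rightarrow> facefun set" where
  "face_per N = cper N \<times> cper N \<times> cper N"

definition avg :: "real \<Rightarrow> real \<Rightarrow> nat \<Rightarrow> gridfun \<Rightarrow> real" where
  "avg a b N v = (mesh a b N) ^ 3 / (b - a) ^ 3 *
     (\<Sum>i=1..int N. \<Sum>j=1..int N. \<Sum>k=1..int N. v i j k)"

definition cper0 :: "real \<Rightarrow> real \<Rightarrow> nat \<Rightarrow> gridfun set" where
  "cper0 a b N = {v \<in> cper N. avg a b N v = 0}"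


definition Dx :: "real \<Rightarrow> gridfun \<Rightarrow> gridfun" where
  "Dx h v = (\<lambda>i j k. (v (i + 1) j k - v i j k) / h)"
definition Dy :: "real \<Rightarrow> gridfun \<Rightarrow> gridfun" where
  "Dy h v = (\<lambda>i j k. (v i (j + 1) k - v i j k) / h)"
definition Dz :: "real \<Rightarrow> gridfun \<Rightarrow> gridfun" where
  "Dz h v = (\<lambda>i j k. (v i j (k + 1) - v i j k) / h)"

definition Ax :: "gridfun \<Rightarrow> gridfun" where
  "Ax v = (\<lambda>i j k. (v (i + 1) j k + v i j k) / 2)"
definition Ay :: "gridfun \<Rightarrow> gridfun" where
  "Ay v = (\<lambda>i j k. (v i (j + 1) k + v i j k) / 2)"
definition Az :: "gridfun \<Rightarrow> gridfun" where
  "Az v = (\<lambda>i j k. (v i j (k + 1) + v i j k) / 2)"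

text \<open>Face-to-centre differences; the face \<open>i - 1/2\<close> is stored at index \<open>i - 1\<close>.\<close>

definition dx :: "real \<Rightarrow> gridfun \<Rightarrow> gridfun" where
  "dx h f = (\<lambda>i j k. (f i j k - f (i - 1) j k) / h)"
definition dy :: "real \<Rightarrow> gridfun \<Rightarrow> gridfun" where
  "dy h f = (\<lambda>i j k. (f i j k - f i (j - 1) k) / h)"
definition dz :: "real \<Rightarrow> gridfun \<Rightarrow> gridfun" where
  "dz h f = (\<lambda>i j k. (f i j k - f i j (k - 1)) / h)"

definition grad_h :: "real \<Rightarrow> gridfun \<Rightarrow> facefun" where
  "grad_h h v = (Dx h v, Dy h v, Dz h v)"

definition face_avg :: "gridfun \<Rightarrow> facefun" where
  "face_avg v = (Ax v, Ay v, Az v)"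

fun div_h :: "real \<Rightarrow> facefun \<Rightarrow> gridfun" where
  "div_h h (f, g, q) = (\<lambda>i j k. dx h f i j k + dy h g i j k + dz h q i j k)"

fun face_mult :: "facefun \<Rightarrow> facefun \<Rightarrow> facefun" where
  "face_mult (D1, D2, D3) (f, g, q) =
     (\<lambda>i j k. D1 i j k * f i j k, \<lambda>i j k. D2 i j k * g i j k, \<lambda>i j k. D3 i j k * q i j k)"

fun face_ge :: "facefun \<Rightarrow> real \<Rightarrow> bool" where
  "face_ge (D1, D2, D3) r \<longleftrightarrow> (\<forall>i j k. D1 i j k \<ge> r \<and> D2 i j k \<ge> r \<and> D3 i j k \<ge> r)"

definition div_grad :: "real \<Rightarrow> facefun \<Rightarrow> gridfun \<Rightarrow> gridfun" where
  "div_grad h D v = div_h h (face_mult D (grad_h h v))"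

definition laplace_h :: "real \<Rightarrow> gridfun \<Rightarrow> gridfun" where
  "laplace_h h v = div_h h (grad_h h v)"


definition grid_inner :: "real \<Rightarrow> nat \<Rightarrow> gridfun \<Rightarrow> gridfun \<Rightarrow> real" where
  "grid_inner h N u w = h ^ 3 *
     (\<Sum>i=1..int N. \<Sum>j=1..int N. \<Sum>k=1..int N. u i j k * w i j k)"

definition face_norm_sq :: "real \<Rightarrow> nat \<Rightarrow> gridfun \<Rightarrow> real" where
  "face_norm_sq h N f = h ^ 3 *
     (\<Sum>i=1..int N. \<Sum>j=1..int N. \<Sum>k=1..int N. \<bar>f i j k\<bar> ^ 2)"

definition grad_norm_sq :: "real \<Rightarrow> nat \<Rightarrow> gridfun \<Rightarrow> real" where
  "grad_norm_sq h N v =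
     face_norm_sq h N (Dx h v) + face_norm_sq h N (Dy h v) + face_norm_sq h N (Dz h v)"

definition L_op :: "real \<Rightarrow> facefun \<Rightarrow> gridfun \<Rightarrow> gridfun" where
  "L_op h D v = (\<lambda>i j k. - div_grad h D v i j k)"

text \<open>Meaningful for \<open>\<phi> \<in> cper0 a b N\<close> and a positive periodic coefficient \<open>D\<close>, where the
  described function exists and is unique.\<close>

definition L_inv :: "real \<Rightarrow> real \<Rightarrow> nat \<Rightarrow> facefun \<Rightarrow> gridfun \<Rightarrow> gridfun" where
  "L_inv a b N D \<phi> = (THE \<theta>. \<theta> \<in> cper0 a b N \<and> L_op (mesh a b N) D \<theta> = \<phi>)"

definition L_inv_norm_sq :: "real \<Rightarrow> real \<Rightarrow> nat \<Rightarrow> facefun \<Rightarrow> gridfun \<Rightarrow> real" where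
  "L_inv_norm_sq a b N D \<phi> = grid_inner (mesh a b N) N \<phi> (L_inv a b N D \<phi>)"


definition pos_semidef :: "real ^ 'm ^ 'm \<Rightarrow> bool" where
  "pos_semidef A \<longleftrightarrow> transpose A = A \<and> (\<forall>x. 0 \<le> x \<bullet> (A *v x))"

text \<open>The finite index type \<open>'m\<close> enumerates the ionic species, so \<open>M = CARD('m)\<close>.\<close>

definition charge :: "('m::finite \<Rightarrow> real) \<Rightarrow> gridfun \<Rightarrow> ('m \<Rightarrow> gridfun) \<Rightarrow> gridfun" where
  "charge z \<rho> c = (\<lambda>i j k. (\<Sum>m\<in>UNIV. z m * c m i j k) + \<rho> i j k)"

text \<open>Given \<open>c\<close> at the current time level, \<open>(c', \<mu>, \<psi>)\<close> is a positive solution at the next one.\<close>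

definition scheme_step ::
  "real \<Rightarrow> real \<Rightarrow> nat \<Rightarrow> real \<Rightarrow> ('m::finite \<Rightarrow> real) \<Rightarrow> ('m \<Rightarrow> real) \<Rightarrow> ('m \<Rightarrow> real) \<Rightarrow> facefun
   \<Rightarrow> real ^ 'm ^ 'm \<Rightarrow> real ^ 'm ^ 'm \<Rightarrow> gridfun
   \<Rightarrow> ('m \<Rightarrow> gridfun) \<Rightarrow> ('m \<Rightarrow> gridfun) \<Rightarrow> ('m \<Rightarrow> gridfun) \<Rightarrow> gridfun \<Rightarrow> bool" where
  "scheme_step a b N dt z \<epsilon> \<sigma> \<kappa> Gc Ge \<rho> c c' \<mu> \<psi> \<longleftrightarrow>
     (let h = mesh a b N in
       (\<forall>m. c' m \<in> cper N) \<and> (\<forall>m i j k. c' m i j k > 0) \<and>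
       (\<forall>m. \<mu> m \<in> cper N) \<and> \<psi> \<in> cper N \<and> avg a b N \<psi> = 0 \<and>
       (\<forall>m i j k. (c' m i j k - c m i j k) / dt
          = \<epsilon> m * div_grad h (face_avg (c m)) (\<mu> m) i j k) \<and>
       (\<forall>m i j k. \<mu> m i j k = z m * \<psi> i j k + ln (c' m i j k)
          + (\<Sum>n\<in>UNIV. Gc $ m $ n * c' n i j k)
          - \<sigma> m * laplace_h h (c' m) i j k
          - (\<Sum>n\<in>UNIV. Ge $ m $ n * c n i j k)) \<and>
       (\<forall>i j k. - div_grad h \<kappa> \<psi> i j k = (\<Sum>m\<in>UNIV. z m * c' m i j k) + \<rho> i j k))"

definition free_energy ::
  "real \<Rightarrow> real \<Rightarrow> nat \<Rightarrow> real \<Rightarrow> ('m::finite \<Rightarrow> real) \<Rightarrow> ('m \<Rightarrow> real) \<Rightarrow> facefun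
   \<Rightarrow> real ^ 'm ^ 'm \<Rightarrow> gridfun \<Rightarrow> ('m \<Rightarrow> gridfun) \<Rightarrow> real" where
  "free_energy a b N v z \<sigma> \<kappa> G \<rho> c =
     (let h = mesh a b N in
       1/2 * L_inv_norm_sq a b N \<kappa> (charge z \<rho> c)
       + (\<Sum>m\<in>UNIV. grid_inner h N (c m) (\<lambda>i j k. ln (v * c m i j k) - 1))
       + 1/2 * (\<Sum>n\<in>UNIV. \<Sum>m\<in>UNIV. G $ m $ n * grid_inner h N (c m) (c n))
       + (\<Sum>m\<in>UNIV. \<sigma> m / 2 * grad_norm_sq h N (c m)))"

end

theory Submission
  imports Defs
begin

text \<open>
  The free energy is a convex functional minus a convex quadratic one, and \<open>\<mu>\<close> treats the
  convex part implicitly and the concave part explicitly. Tangent inequalities, one for each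
  contribution, therefore give \<open>F(c') - F(c) \<le> \<Sum>\<^sub>m \<langle>\<mu>\<^sub>m, c'\<^sub>m - c\<^sub>m\<rangle>\<close>; the
  constant \<open>ln v\<close> in the derivative of the entropy drops out by conservation of mass. Inserting the evolution
  equation and summing by parts turns the right-hand side into minus the sum of
  \<open>dt \<epsilon>\<^sub>m\<close> times the dissipation \<open>\<langle>A c\<^sub>m \<nabla>\<mu>\<^sub>m, \<nabla>\<mu>\<^sub>m\<rangle>\<close>, which is nonnegative.
  The electrostatic energy at the old time level only has its meaning once \<open>- \<nabla> \<sqdot> (\<kappa> \<nabla> \<theta>) = \<phi>\<close>
  is known to be solvable in mean-zero functions, which is a dimension count.
\<close>

section \<open>Underdetermined homogeneous linear systems\<close>

lemma underdetermined_homogeneous_system: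
  fixes K :: "'e \<Rightarrow> 't \<Rightarrow> real"
  assumes "finite E" and "finite U" and "card E < card U"
  shows "\<exists>u. (\<exists>t\<in>U. u t \<noteq> 0) \<and> (\<forall>e\<in>E. (\<Sum>t\<in>U. K e t * u t) = 0)"
  using assms
proof (induction E arbitrary: U K rule: finite_induct)
  case empty
  then have "U \<noteq> {}" by auto
  then show ?case by (intro exI[of _ "\<lambda>_. 1"]) auto
next
  case (insert e E)
  show ?case
  proof (cases "\<forall>t\<in>U. K e t = 0")
    case True
    \<comment> \<open>The equation \<open>e\<close> is vacuous here, and dropping it keeps more
      unknowns than equations.\<close>
    have "card E < card U" using insert by simp
    then obtain u where "\<exists>t\<in>U. u t \<noteq> 0" "\<forall>e\<in>E. (\<Sum>t\<in>U. K e t * u t) = 0"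
      using insert.IH[of U K] insert.prems by blast
    then show ?thesis using True by (intro exI[of _ u]) auto
  next
    case False
    then obtain p where p: "p \<in> U" "K e p \<noteq> 0" by blast
    define V where "V = U - {p}"
    have V: "finite V" "p \<notin> V" "U = insert p V" using p insert.prems by (auto simp: V_def)
    then have "card E < card V" using insert by simp
    \<comment> \<open>Gaussian elimination with pivot \<open>K e p\<close>: equation
      \<open>e\<close> is solved for the unknown \<open>p\<close>, and substituting into the other
      equations gives these coefficients on the unknowns in \<open>V\<close>.\<close>
    then obtain w where w: "\<exists>t\<in>V. w t \<noteq> 0"
      "\<forall>e'\<in>E. (\<Sum>t\<in>V. (K e' t - K e' p * K e t / K e p) * w t) = 0"
      using insert.IH[of V "\<lambda>e' t. K e' t - K e' p * K e t / K e p"] V by blast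
    define r where "r = (\<Sum>t\<in>V. K e t * w t)"
    \<comment> \<open>Back substitution: this value at \<open>p\<close> is the one that makes
      equation \<open>e\<close> hold.\<close>
    define u where "u = w(p := - r / K e p)"
    have S: "(\<Sum>t\<in>U. K e' t * u t) = - K e' p * r / K e p + (\<Sum>t\<in>V. K e' t * w t)" for e'
    proof -
      have "(\<Sum>t\<in>V. K e' t * u t) = (\<Sum>t\<in>V. K e' t * w t)"
        using V by (intro sum.cong) (auto simp: u_def)
      then show ?thesis using V by (simp add: u_def)
    qed
    have "(\<Sum>t\<in>U. K e' t * u t) = 0" if "e' \<in> E" for e'
    proof -
      have "0 = (\<Sum>t\<in>V. K e' t * w t - (K e' p / K e p) * (K e t * w t))"
        using w(2) that by (auto simp: algebra_simps intro!: sum.cong)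
      also have "\<dots> = (\<Sum>t\<in>V. K e' t * w t) - (K e' p / K e p) * r"
        by (simp add: sum_subtractf sum_distrib_left r_def)
      finally show ?thesis unfolding S by simp
    qed
    moreover have "(\<Sum>t\<in>U. K e t * u t) = 0" unfolding S using p by (simp add: r_def)
    moreover have "\<exists>t\<in>U. u t \<noteq> 0" using w(1) V by (auto simp: u_def)
    ultimately show ?thesis by blast
  qed
qed

section \<open>Sums over one period and closure properties of periodic functions\<close>

definition gsum :: "nat \<Rightarrow> gridfun \<Rightarrow> real" where
  "gsum N u = (\<Sum>i=1..int N. \<Sum>j=1..int N. \<Sum>k=1..int N. u i j k)"

text \<open>Splits off the weight: identities and inequalities are proved for unweighted sums, and
  \<open>h ^ 3\<close> enters only as a nonnegative factor at the end.\<close>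

lemma grid_inner_gsum: "grid_inner h N u w = h ^ 3 * gsum N (\<lambda>i j k. u i j k * w i j k)"
  by (simp add: grid_inner_def gsum_def)

lemma gsum_add: "gsum N (\<lambda>i j k. u i j k + w i j k) = gsum N u + gsum N w"
  by (simp add: gsum_def sum.distrib)

lemma gsum_diff: "gsum N (\<lambda>i j k. u i j k - w i j k) = gsum N u - gsum N w"
  by (simp add: gsum_def sum_subtractf)

lemma gsum_minus: "gsum N (\<lambda>i j k. - u i j k) = - gsum N u"
  by (simp add: gsum_def sum_negf)

lemma gsum_cmult: "gsum N (\<lambda>i j k. r * u i j k) = r * gsum N u"
  by (simp add: gsum_def sum_distrib_left)

lemma gsum_sum: "gsum N (\<lambda>i j k. \<Sum>m\<in>A. u m i j k) = (\<Sum>m\<in>A. gsum N (u m))"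
  by (induction A rule: infinite_finite_induct) (simp_all add: gsum_add, simp_all add: gsum_def)

lemma gsum_mono:
  assumes "\<And>i j k. u i j k \<le> w i j k"
  shows "gsum N u \<le> gsum N w"
  unfolding gsum_def by (intro sum_mono assms)

lemma gsum_nonneg:
  assumes "\<And>i j k. 0 \<le> u i j k"
  shows "0 \<le> gsum N u"
  unfolding gsum_def by (intro sum_nonneg assms)

lemma gsum_nonneg_eq_0D:
  assumes "\<And>i j k. 0 \<le> u i j k" "gsum N u = 0"
    and "i \<in> {1..int N}" "j \<in> {1..int N}" "k \<in> {1..int N}"
  shows "u i j k = 0"
  using assms unfolding gsum_def
  by (simp add: sum_nonneg_eq_0_iff sum_nonneg)

lemma gsum_const: "gsum N (\<lambda>i j k. r) = real N ^ 3 * r"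
  by (simp add: gsum_def power3_eq_cube)

text \<open>The windows {0..N-1} and {1..N} differ only in an end point, and \<open>f\<close> agrees
  at 0 and at N.\<close>

lemma sum_period_shift:
  fixes f :: "int \<Rightarrow> real"
  assumes "\<And>i. f (i + int N) = f i"
  shows "(\<Sum>i=1..int N. f (i - 1)) = (\<Sum>i=1..int N. f i)"
proof (cases "N = 0")
  case False
  have "(\<Sum>i=1..int N. f (i - 1)) = (\<Sum>i=0..int N - 1. f i)"
    by (rule sum.reindex_bij_witness[of _ "\<lambda>i. i + 1" "\<lambda>i. i - 1"]) auto
  also have "{0..int N - 1} = insert 0 {1..int N - 1}" using False by auto
  also have "sum f \<dots> = f (int N) + sum f {1..int N - 1}" using assms[of 0] by simp
  also have "\<dots> = sum f (insert (int N) {1..int N - 1})" by simp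
  also have "insert (int N) {1..int N - 1} = {1..int N}" using False by auto
  finally show ?thesis .
qed simp

lemma cperD:
  assumes "v \<in> cper N"
  shows "v (i + int N) j k = v i j k" "v i (j + int N) k = v i j k" "v i j (k + int N) = v i j k"
proof -
  have "v i j k = v (i + \<alpha> * int N) (j + \<beta> * int N) (k + \<gamma> * int N)" for \<alpha> \<beta> \<gamma>
    using assms by (auto simp: cper_def)
  from this[of 1 0 0] this[of 0 1 0] this[of 0 0 1]
  show "v (i + int N) j k = v i j k" "v i (j + int N) k = v i j k" "v i j (k + int N) = v i j k"
    by simp_all
qed

lemma cper_pointwise:
  assumes "u \<in> cper N" "w \<in> cper N"
  shows "(\<lambda>i j k. F (u i j k) (w i j k)) \<in> cper N"
  using assms unfolding cper_def by (auto intro!: arg_cong2[where f = F])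

lemma cper_map: "u \<in> cper N \<Longrightarrow> (\<lambda>i j k. F (u i j k)) \<in> cper N"
  using cper_pointwise[where F = "\<lambda>x y. F x"] .

lemma cper_shift:
  assumes "u \<in> cper N"
  shows "(\<lambda>i j k. u (i + p) (j + q) (k + r)) \<in> cper N"
  unfolding cper_def
proof (intro CollectI allI)
  fix i j k \<alpha> \<beta> \<gamma>
  have "u (i + p) (j + q) (k + r)
      = u (i + p + \<alpha> * int N) (j + q + \<beta> * int N) (k + r + \<gamma> * int N)"
    using assms unfolding cper_def by blast
  then show "u (i + p) (j + q) (k + r)
      = u (i + \<alpha> * int N + p) (j + \<beta> * int N + q) (k + \<gamma> * int N + r)"
    by (simp add: algebra_simps)
qed

section \<open>Difference operators, summation by parts and discrete Green identities\<close>

lemma difference_linear: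
  "Dx h (\<lambda>i j k. r * u i j k + s * w i j k) i j k = r * Dx h u i j k + s * Dx h w i j k"
  "Dy h (\<lambda>i j k. r * u i j k + s * w i j k) i j k = r * Dy h u i j k + s * Dy h w i j k"
  "Dz h (\<lambda>i j k. r * u i j k + s * w i j k) i j k = r * Dz h u i j k + s * Dz h w i j k"
  unfolding Dx_def Dy_def Dz_def
  by (simp_all add: algebra_simps add_divide_distrib diff_divide_distrib)

lemma difference_diff:
  "Dx h (\<lambda>i j k. u i j k - w i j k) i j k = Dx h u i j k - Dx h w i j k"
  "Dy h (\<lambda>i j k. u i j k - w i j k) i j k = Dy h u i j k - Dy h w i j k"
  "Dz h (\<lambda>i j k. u i j k - w i j k) i j k = Dz h u i j k - Dz h w i j k"
  by (simp_all add: Dx_def Dy_def Dz_def diff_divide_distrib)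

lemma cper_differences:
  assumes "u \<in> cper N"
  shows "Dx h u \<in> cper N" "Dy h u \<in> cper N" "Dz h u \<in> cper N"
    and "dx h u \<in> cper N" "dy h u \<in> cper N" "dz h u \<in> cper N"
    and "Ax u \<in> cper N" "Ay u \<in> cper N" "Az u \<in> cper N"
  using cper_pointwise[OF cper_shift[OF assms, of 1 0 0] assms, of "\<lambda>x y. (x - y) / h"]
    cper_pointwise[OF cper_shift[OF assms, of 0 1 0] assms, of "\<lambda>x y. (x - y) / h"]
    cper_pointwise[OF cper_shift[OF assms, of 0 0 1] assms, of "\<lambda>x y. (x - y) / h"]
    cper_pointwise[OF assms cper_shift[OF assms, of "-1" 0 0], of "\<lambda>x y. (x - y) / h"]
    cper_pointwise[OF assms cper_shift[OF assms, of 0 "-1" 0], of "\<lambda>x y. (x - y) / h"]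
    cper_pointwise[OF assms cper_shift[OF assms, of 0 0 "-1"], of "\<lambda>x y. (x - y) / h"]
    cper_pointwise[OF cper_shift[OF assms, of 1 0 0] assms, of "\<lambda>x y. (x + y) / 2"]
    cper_pointwise[OF cper_shift[OF assms, of 0 1 0] assms, of "\<lambda>x y. (x + y) / 2"]
    cper_pointwise[OF cper_shift[OF assms, of 0 0 1] assms, of "\<lambda>x y. (x + y) / 2"]
  by (simp_all add: Dx_def Dy_def Dz_def dx_def dy_def dz_def Ax_def Ay_def Az_def)

lemma face_avg_per: "u \<in> cper N \<Longrightarrow> face_avg u \<in> face_per N"
  by (simp add: face_avg_def face_per_def cper_differences)

lemma gsum_shift:
  assumes "u \<in> cper N"
  shows "gsum N (\<lambda>i j k. u (i - 1) j k) = gsum N u"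
    and "gsum N (\<lambda>i j k. u i (j - 1) k) = gsum N u"
    and "gsum N (\<lambda>i j k. u i j (k - 1)) = gsum N u"
proof -
  show "gsum N (\<lambda>i j k. u (i - 1) j k) = gsum N u" unfolding gsum_def
    by (rule sum_period_shift[where f = "\<lambda>i. \<Sum>j=1..int N. \<Sum>k=1..int N. u i j k"])
      (simp add: cperD[OF assms])
  show "gsum N (\<lambda>i j k. u i (j - 1) k) = gsum N u" unfolding gsum_def
    by (intro sum.cong refl sum_period_shift[where f = "\<lambda>j. \<Sum>k=1..int N. u _ j k"])
      (simp add: cperD[OF assms])
  show "gsum N (\<lambda>i j k. u i j (k - 1)) = gsum N u" unfolding gsum_def
    by (intro sum.cong refl sum_period_shift) (simp add: cperD[OF assms])
qed

text \<open>In the x-direction, u * dx f + f * Dx u is the backward difference quotient of the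
  product u(i+1) f(i), because \<open>dx\<close> looks backward and \<open>Dx\<close> forward. By
  periodicity its sum over a period is zero. The other two directions are the same.\<close>

lemma summation_by_parts:
  assumes u: "u \<in> cper N" and f: "f \<in> cper N"
  shows "gsum N (\<lambda>i j k. u i j k * dx h f i j k) = - gsum N (\<lambda>i j k. f i j k * Dx h u i j k)"
    and "gsum N (\<lambda>i j k. u i j k * dy h f i j k) = - gsum N (\<lambda>i j k. f i j k * Dy h u i j k)"
    and "gsum N (\<lambda>i j k. u i j k * dz h f i j k) = - gsum N (\<lambda>i j k. f i j k * Dz h u i j k)"
proof -
  have X: "(\<lambda>i j k. u (i + 1) j k * f i j k) \<in> cper N"
    "(\<lambda>i j k. u i (j + 1) k * f i j k) \<in> cper N"
    "(\<lambda>i j k. u i j (k + 1) * f i j k) \<in> cper N"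
    using cper_pointwise[OF cper_shift[OF u, of 1 0 0] f, of "(*)"]
      cper_pointwise[OF cper_shift[OF u, of 0 1 0] f, of "(*)"]
      cper_pointwise[OF cper_shift[OF u, of 0 0 1] f, of "(*)"] by simp_all
  note S = gsum_shift(1)[OF X(1)] gsum_shift(2)[OF X(2)] gsum_shift(3)[OF X(3)]
  have "gsum N (\<lambda>i j k. u i j k * dx h f i j k) + gsum N (\<lambda>i j k. f i j k * Dx h u i j k)
      = gsum N (\<lambda>i j k. 1 / h * (u (i + 1) j k * f i j k - u i j k * f (i - 1) j k))"
    unfolding gsum_add[symmetric]
    by (simp add: dx_def Dx_def algebra_simps diff_divide_distrib)
  also have "\<dots> = 0" unfolding gsum_cmult gsum_diff using S(1) by simp
  finally show "gsum N (\<lambda>i j k. u i j k * dx h f i j k) = - gsum N (\<lambda>i j k. f i j k * Dx h u i j k)"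
    by simp
  have "gsum N (\<lambda>i j k. u i j k * dy h f i j k) + gsum N (\<lambda>i j k. f i j k * Dy h u i j k)
      = gsum N (\<lambda>i j k. 1 / h * (u i (j + 1) k * f i j k - u i j k * f i (j - 1) k))"
    unfolding gsum_add[symmetric]
    by (simp add: dy_def Dy_def algebra_simps diff_divide_distrib)
  also have "\<dots> = 0" unfolding gsum_cmult gsum_diff using S(2) by simp
  finally show "gsum N (\<lambda>i j k. u i j k * dy h f i j k) = - gsum N (\<lambda>i j k. f i j k * Dy h u i j k)"
    by simp
  have "gsum N (\<lambda>i j k. u i j k * dz h f i j k) + gsum N (\<lambda>i j k. f i j k * Dz h u i j k)
      = gsum N (\<lambda>i j k. 1 / h * (u i j (k + 1) * f i j k - u i j k * f i j (k - 1)))"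
    unfolding gsum_add[symmetric]
    by (simp add: dz_def Dz_def algebra_simps diff_divide_distrib)
  also have "\<dots> = 0" unfolding gsum_cmult gsum_diff using S(3) by simp
  finally show "gsum N (\<lambda>i j k. u i j k * dz h f i j k) = - gsum N (\<lambda>i j k. f i j k * Dz h u i j k)"
    by simp
qed

text \<open>The three products belong to three different faces and merely share an index; summed
  over one period, every face is counted once.\<close>

fun face_dot :: "facefun \<Rightarrow> facefun \<Rightarrow> gridfun" where
  "face_dot (f, g, q) (f', g', q') = (\<lambda>i j k. f i j k * f' i j k + g i j k * g' i j k + q i j k * q' i j k)"

lemma face_dot_grad_self:
  "face_dot (face_mult (D1, D2, D3) (grad_h h u)) (grad_h h u)
    = (\<lambda>i j k. D1 i j k * (Dx h u i j k)\<^sup>2 + D2 i j k * (Dy h u i j k)\<^sup>2 + D3 i j k * (Dz h u i j k)\<^sup>2)"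
  by (simp add: grad_h_def power2_eq_square mult.assoc)

lemma face_dot_grad_commute:
  "face_dot (face_mult D (grad_h h u)) (grad_h h w) = face_dot (face_mult D (grad_h h w)) (grad_h h u)"
  by (cases D) (simp add: grad_h_def mult_ac)

lemma green_div:
  assumes "u \<in> cper N" "F \<in> face_per N"
  shows "gsum N (\<lambda>i j k. u i j k * div_h h F i j k) = - gsum N (face_dot F (grad_h h u))"
  using assms
  by (cases F) (simp add: grad_h_def face_per_def distrib_left gsum_add summation_by_parts)

lemma face_mult_grad_per:
  assumes "D \<in> face_per N" "w \<in> cper N"
  shows "face_mult D (grad_h h w) \<in> face_per N"
  using assms by (cases D) (simp add: grad_h_def face_per_def cper_pointwise cper_differences)

lemma green:
  assumes "u \<in> cper N" "w \<in> cper N" "D \<in> face_per N"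
  shows "gsum N (\<lambda>i j k. u i j k * div_grad h D w i j k)
    = - gsum N (face_dot (face_mult D (grad_h h w)) (grad_h h u))"
  unfolding div_grad_def using assms by (intro green_div face_mult_grad_per)

lemma div_grad_per:
  assumes "w \<in> cper N" "D \<in> face_per N"
  shows "div_grad h D w \<in> cper N"
proof -
  obtain f g q where F: "face_mult D (grad_h h w) = (f, g, q)" by (metis prod_cases3)
  have "f \<in> cper N" "g \<in> cper N" "q \<in> cper N"
    using face_mult_grad_per[OF assms(2,1), of h] by (auto simp: F face_per_def)
  then show ?thesis
    unfolding div_grad_def F div_h.simps
    by (intro cper_pointwise[where F = "(+)"] cper_differences)
qed

lemma face_ge_nonneg_energy:
  assumes "face_ge D r" "0 \<le> r"
  shows "0 \<le> face_dot (face_mult D (grad_h h u)) (grad_h h u) i j k"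
proof -
  obtain D1 D2 D3 where D: "D = (D1, D2, D3)" by (metis prod_cases3)
  have "0 \<le> D1 i j k" "0 \<le> D2 i j k" "0 \<le> D3 i j k"
    using assms by (auto simp: D intro: order_trans)
  then show ?thesis unfolding D face_dot_grad_self by simp
qed

section \<open>Mean-zero functions and reduction to one period\<close>

lemma avg_eq_gsum: "avg a b N u = (mesh a b N) ^ 3 / (b - a) ^ 3 * gsum N u"
  by (simp add: avg_def gsum_def)

lemma cper0_iff:
  assumes "a < b" "N > 0"
  shows "u \<in> cper0 a b N \<longleftrightarrow> u \<in> cper N \<and> gsum N u = 0"
  using assms by (simp add: cper0_def avg_eq_gsum mesh_def)

text \<open>The representative of \<open>i\<close> modulo \<open>N\<close> in the summation window
  {1..N}, hence the shift by one around \<open>mod\<close>.\<close>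

definition rep :: "nat \<Rightarrow> int \<Rightarrow> int" where
  "rep N i = (i - 1) mod int N + 1"

lemma rep_mem:
  assumes "N > 0"
  shows "rep N i \<in> {1..int N}"
proof -
  have "0 < int N" using assms by simp
  from pos_mod_bound[OF this, of "i - 1"] pos_mod_sign[OF this, of "i - 1"]
  show ?thesis unfolding rep_def atLeastAtMost_iff by linarith
qed

lemma rep_id: "i \<in> {1..int N} \<Longrightarrow> rep N i = i"
  by (simp add: rep_def)

lemma rep_add: "rep N (i + \<alpha> * int N) = rep N i"
proof -
  have "i + \<alpha> * int N - 1 = i - 1 + \<alpha> * int N" by simp
  then show ?thesis unfolding rep_def by (simp only: mod_mult_self1)
qed

lemma cper_rep:
  assumes "u \<in> cper N"
  shows "u (rep N i) (rep N j) (rep N k) = u i j k"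
proof -
  define p where "p i = - ((i - 1) div int N)" for i
  have "rep N i = i + p i * int N" for i
    by (simp add: rep_def p_def minus_div_mult_eq_mod[symmetric])
  moreover have "u i j k = u (i + p i * int N) (j + p j * int N) (k + p k * int N)"
    using assms unfolding cper_def by blast
  ultimately show ?thesis by simp
qed

lemma cper_eqI:
  assumes "u \<in> cper N" "w \<in> cper N" "N > 0"
    and "\<And>i j k. i \<in> {1..int N} \<Longrightarrow> j \<in> {1..int N} \<Longrightarrow> k \<in> {1..int N} \<Longrightarrow> u i j k = w i j k"
  shows "u = w"
proof (intro ext)
  fix i j k
  show "u i j k = w i j k"
    using assms(4)[OF rep_mem rep_mem rep_mem, of i j k] assms(3)
    by (simp add: cper_rep[OF assms(1)] cper_rep[OF assms(2)])
qed

section \<open>Kernel, uniqueness and solvability of the discrete elliptic equation\<close>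

lemma int_step_const:
  fixes f :: "int \<Rightarrow> 'a"
  assumes "\<And>i. f (i + 1) = f i"
  shows "f i = f 0"
proof (induction i rule: int_induct[of _ 0])
  case (step2 i)
  then show ?case using assms[of "i - 1"] by simp
qed (use assms in auto)

text \<open>A vanishing sum of nonnegative terms kills each term, so with a positive coefficient all
  differences vanish on one period and then, by periodicity, everywhere. Such a function is constant
  along each lattice direction, hence constant, and mean zero makes the constant 0.\<close>

lemma zero_energy_imp_zero:
  assumes "h > 0" "N > 0" "u \<in> cper N" "gsum N u = 0"
    and D: "D \<in> face_per N" "face_ge D r" "r > 0"
    and E: "gsum N (face_dot (face_mult D (grad_h h u)) (grad_h h u)) = 0"
  shows "u = (\<lambda>i j k. 0)"
proof -
  obtain D1 D2 D3 where D_eq: "D = (D1, D2, D3)" by (metis prod_cases3)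
  have pos: "D1 i j k > 0" "D2 i j k > 0" "D3 i j k > 0" for i j k
    using D by (auto simp: D_eq intro: less_le_trans)
  have Z: "Dx h u i j k = 0 \<and> Dy h u i j k = 0 \<and> Dz h u i j k = 0"
    if "i \<in> {1..int N}" "j \<in> {1..int N}" "k \<in> {1..int N}" for i j k
  proof -
    have "face_dot (face_mult D (grad_h h u)) (grad_h h u) i j k = 0"
      using face_ge_nonneg_energy[OF D(2)] D(3) E that by (intro gsum_nonneg_eq_0D) auto
    then have "D1 i j k * (Dx h u i j k)\<^sup>2 + D2 i j k * (Dy h u i j k)\<^sup>2 + D3 i j k * (Dz h u i j k)\<^sup>2 = 0"
      unfolding D_eq face_dot_grad_self .
    moreover have "0 \<le> D1 i j k * (Dx h u i j k)\<^sup>2" "0 \<le> D2 i j k * (Dy h u i j k)\<^sup>2"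
      "0 \<le> D3 i j k * (Dz h u i j k)\<^sup>2"
      using pos by (simp_all add: less_imp_le)
    ultimately have "D1 i j k * (Dx h u i j k)\<^sup>2 = 0" "D2 i j k * (Dy h u i j k)\<^sup>2 = 0"
      "D3 i j k * (Dz h u i j k)\<^sup>2 = 0" by linarith+
    then show ?thesis using pos[of i j k] by simp
  qed
  have zero: "(\<lambda>i j k. 0) \<in> cper N" by (simp add: cper_def)
  have "Dx h u = (\<lambda>i j k. 0)" "Dy h u = (\<lambda>i j k. 0)" "Dz h u = (\<lambda>i j k. 0)"
    using Z assms(2) by (auto intro!: cper_eqI[OF _ zero] cper_differences assms(3))
  then have "u (i + 1) j k = u i j k" "u i (j + 1) k = u i j k" "u i j (k + 1) = u i j k" for i j k
    using \<open>h > 0\<close> by (auto simp: Dx_def Dy_def Dz_def fun_eq_iff)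
  then have "u i j k = u 0 0 0" for i j k
    using int_step_const[of "\<lambda>i. u i j k" i] int_step_const[of "\<lambda>j. u 0 j k" j]
      int_step_const[of "\<lambda>k. u 0 0 k" k] by simp
  then have u: "u = (\<lambda>i j k. u 0 0 0)" by (intro ext)
  then have "real N ^ 3 * u 0 0 0 = 0" using assms(4) gsum_const by metis
  then have "u 0 0 0 = 0" using \<open>N > 0\<close> by simp
  then show ?thesis using u by simp
qed

text \<open>The energy form on the right is the source of both the symmetry of \<open>L_op\<close>
  and, for nonnegative coefficients, its positivity.\<close>

lemma L_op_gsum:
  assumes "u \<in> cper N" "w \<in> cper N" "D \<in> face_per N"
  shows "gsum N (\<lambda>i j k. u i j k * L_op h D w i j k)
    = gsum N (face_dot (face_mult D (grad_h h w)) (grad_h h u))"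
  by (simp add: L_op_def gsum_minus green[OF assms])

lemma L_op_per: "w \<in> cper N \<Longrightarrow> D \<in> face_per N \<Longrightarrow> L_op h D w \<in> cper N"
  unfolding L_op_def by (rule cper_map[OF div_grad_per])

text \<open>Testing with the constant 1, whose differences vanish. This is the compatibility
  condition in the solvability proof and conservation of mass in the time step.\<close>

lemma gsum_L_op:
  assumes "w \<in> cper N" "D \<in> face_per N"
  shows "gsum N (L_op h D w) = 0"
proof -
  have "(\<lambda>i j k. 1) \<in> cper N" by (simp add: cper_def)
  from L_op_gsum[OF this assms] show ?thesis
    by (cases D) (simp add: grad_h_def Dx_def Dy_def Dz_def gsum_const[of N 0])
qed

lemma L_op_linear:
  "L_op h D (\<lambda>i j k. r * u i j k + s * w i j k) i j k = r * L_op h D u i j k + s * L_op h D w i j k"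
proof -
  obtain D1 D2 D3 where D: "D = (D1, D2, D3)" by (metis prod_cases3)
  \<comment> \<open>The shape of one flux difference, with \<open>y\<close> and \<open>y'\<close>
    the coefficients on the two opposite faces; a single rewrite rule then serves all three
    directions.\<close>
  have lin: "(y * (r * p + s * q) - y' * (r * p' + s * q')) / h
      = r * ((y * p - y' * p') / h) + s * ((y * q - y' * q') / h)" for y y' p q p' q' :: real
    by (simp add: algebra_simps add_divide_distrib diff_divide_distrib)
  show ?thesis
    unfolding D L_op_def div_grad_def grad_h_def face_mult.simps div_h.simps
      dx_def dy_def dz_def difference_linear lin
    by (simp add: algebra_simps)
qed

lemma L_op_diff:
  "L_op h D (\<lambda>i j k. u i j k - w i j k) i j k = L_op h D u i j k - L_op h D w i j k"
  using L_op_linear[of h D 1 u "-1" w] by simp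

lemma L_op_cmult: "L_op h D (\<lambda>i j k. r * u i j k) i j k = r * L_op h D u i j k"
  using L_op_linear[of h D r u 0 u] by simp

lemma L_op_sum:
  "L_op h D (\<lambda>i j k. \<Sum>t\<in>A. x t * u t i j k) i j k = (\<Sum>t\<in>A. x t * L_op h D (u t) i j k)"
proof (induction A rule: infinite_finite_induct)
  case (insert t A)
  then show ?case
    using L_op_linear[of h D "x t" "u t" 1 "\<lambda>i j k. \<Sum>t\<in>A. x t * u t i j k"] by simp
qed (use L_op_cmult[of h D 0 "\<lambda>i j k. 0"] in simp_all)

lemma L_op_eq_0_imp_zero:
  assumes "h > 0" "N > 0" "u \<in> cper N" "gsum N u = 0"
    and D: "D \<in> face_per N" "face_ge D r" "r > 0"
    and "L_op h D u = (\<lambda>i j k. 0)"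
  shows "u = (\<lambda>i j k. 0)"
  using assms L_op_gsum[OF assms(3,3) D(1), of h]
  by (intro zero_energy_imp_zero[OF assms(1-4) D]) (simp add: gsum_const[of N 0])

text \<open>Adding the mean makes the operator injective on all periodic functions. The bordered
  homogeneous system \<open>L u + gsum u = \<tau> \<phi>\<close> in the unknowns \<open>(u, \<tau>)\<close> has one unknown more than it has
  equations; injectivity forces \<open>\<tau> \<noteq> 0\<close> in a nontrivial solution.\<close>

lemma L_op_surj:
  assumes "h > 0" "N > 0" and D: "D \<in> face_per N" "face_ge D r" "r > 0"
    and \<phi>: "\<phi> \<in> cper N" "gsum N \<phi> = 0"
  shows "\<exists>u. u \<in> cper N \<and> gsum N u = 0 \<and> L_op h D u = \<phi>"
proof -
  define B where "B = {1..int N} \<times> {1..int N} \<times> {1..int N}"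
  \<comment> \<open>The basis of periodic functions: the periodic extension of the indicator of cell
    \<open>t\<close>.\<close>
  define e where "e t = (\<lambda>i j k. if (rep N i, rep N j, rep N k) = t then 1 else 0 :: real)" for t
  \<comment> \<open>The matrix of the bordered system. A column \<open>Some t\<close> belongs to the
    value of \<open>u\<close> in cell \<open>t\<close>, and the extra column \<open>None\<close> to
    \<tau>.\<close>
  define K where "K s t = (case s of (i, j, k) \<Rightarrow>
    (case t of None \<Rightarrow> - \<phi> i j k | Some t \<Rightarrow> L_op h D (e t) i j k + gsum N (e t)))" for s t
  have fin: "finite B" by (simp add: B_def)
  let ?U = "insert None (Some ` B)"
  have "card B < card ?U" using fin by (simp add: card_image)
  then obtain x where x: "\<exists>t\<in>?U. x t \<noteq> 0" "\<forall>s\<in>B. (\<Sum>t\<in>?U. K s t * x t) = 0"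
    using underdetermined_homogeneous_system[of B ?U K] fin by auto
  define \<tau> where "\<tau> = x None"
  define u where "u = (\<lambda>i j k. x (Some (rep N i, rep N j, rep N k)))"
  have u_per: "u \<in> cper N" by (simp add: u_def cper_def rep_add)
  have u_sum: "u = (\<lambda>i j k. \<Sum>t\<in>B. x (Some t) * e t i j k)"
    using fin rep_mem[OF \<open>N > 0\<close>] by (simp add: u_def e_def B_def sum.delta' if_distrib cong: if_cong)
  have eq: "L_op h D u i j k + gsum N u = \<tau> * \<phi> i j k" if "(i, j, k) \<in> B" for i j k
  proof -
    have "0 = (\<Sum>t\<in>?U. K (i, j, k) t * x t)" using x(2) that by simp
    also have "\<dots> = - \<tau> * \<phi> i j k
        + (\<Sum>t\<in>B. x (Some t) * L_op h D (e t) i j k + x (Some t) * gsum N (e t))"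
      using fin by (simp add: K_def \<tau>_def sum.reindex algebra_simps)
    also have "\<dots> = - \<tau> * \<phi> i j k + (L_op h D u i j k + gsum N u)"
      unfolding u_sum by (simp add: L_op_sum sum.distrib gsum_sum gsum_cmult)
    finally show ?thesis by simp
  qed
  \<comment> \<open>The system only gives the equation in the cells of one period; both sides are
    periodic, so it holds at all indices.\<close>
  have "(\<lambda>i j k. L_op h D u i j k + gsum N u) = (\<lambda>i j k. \<tau> * \<phi> i j k)"
  proof (rule cper_eqI[OF _ _ \<open>N > 0\<close>])
    show "(\<lambda>i j k. L_op h D u i j k + gsum N u) \<in> cper N"
      by (rule cper_map[OF L_op_per[OF u_per D(1)]])
    show "(\<lambda>i j k. \<tau> * \<phi> i j k) \<in> cper N"
      by (rule cper_map[OF \<phi>(1)])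
  qed (use eq in \<open>simp add: B_def\<close>)
  then have eq': "L_op h D u i j k + gsum N u = \<tau> * \<phi> i j k" for i j k by (simp add: fun_eq_iff)
  \<comment> \<open>Summing the equation over a period isolates the mean of \<open>u\<close>, since
    both \<open>L_op h D u\<close> and \<phi> have sum zero. The added term therefore vanishes, and
    dividing by \<tau> yields the desired solution.\<close>
  have "gsum N (\<lambda>i j k. L_op h D u i j k + gsum N u) = real N ^ 3 * gsum N u"
    unfolding gsum_add gsum_const by (simp add: gsum_L_op[OF u_per D(1)])
  moreover have "gsum N (\<lambda>i j k. L_op h D u i j k + gsum N u) = 0"
    unfolding eq' gsum_cmult by (simp add: \<phi>)
  ultimately have u0: "gsum N u = 0" using \<open>N > 0\<close> by simp
  have "\<tau> \<noteq> 0"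
  proof
    assume "\<tau> = 0"
    then have "L_op h D u = (\<lambda>i j k. 0)" using eq' u0 by (simp add: fun_eq_iff)
    then have "u = (\<lambda>i j k. 0)" by (intro L_op_eq_0_imp_zero[OF assms(1,2) u_per u0 D])
    moreover have "x (Some (i, j, k)) = u i j k" if "(i, j, k) \<in> B" for i j k
      using that by (simp add: u_def B_def rep_id)
    ultimately have "x (Some t) = 0" if "t \<in> B" for t using that by (cases t) simp
    then show False using x(1) \<open>\<tau> = 0\<close> by (auto simp: \<tau>_def)
  qed
  let ?w = "\<lambda>i j k. (1 / \<tau>) * u i j k"
  have "?w \<in> cper N" by (rule cper_map[OF u_per])
  moreover have "gsum N ?w = 0" unfolding gsum_cmult u0 by simp
  moreover have "L_op h D ?w = \<phi>"
    using eq' u0 \<open>\<tau> \<noteq> 0\<close> unfolding fun_eq_iff L_op_cmult by simp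
  ultimately show ?thesis by blast
qed

text \<open>Makes the definite description in \<open>L_inv\<close> usable: two mean-zero solutions
  differ by an element of the trivial kernel, so any solution at hand, be it \<psi> or one supplied
  by \<open>L_op_surj\<close>, is the inverse.\<close>

lemma L_inv_eqI:
  assumes "a < b" "N > 0" and D: "D \<in> face_per N" "face_ge D r" "r > 0"
    and "\<theta> \<in> cper N" "gsum N \<theta> = 0" "L_op (mesh a b N) D \<theta> = \<phi>"
  shows "L_inv a b N D \<phi> = \<theta>"
  unfolding L_inv_def
proof (rule the_equality)
  show "\<theta> \<in> cper0 a b N \<and> L_op (mesh a b N) D \<theta> = \<phi>" using assms by (simp add: cper0_iff)
next
  fix \<eta> assume "\<eta> \<in> cper0 a b N \<and> L_op (mesh a b N) D \<eta> = \<phi>"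
  then have \<eta>: "\<eta> \<in> cper N" "gsum N \<eta> = 0" "L_op (mesh a b N) D \<eta> = \<phi>"
    using assms by (simp_all add: cper0_iff)
  have "(\<lambda>i j k. \<eta> i j k - \<theta> i j k) = (\<lambda>i j k. 0)"
  proof (rule L_op_eq_0_imp_zero[OF _ \<open>N > 0\<close> _ _ D])
    show "0 < mesh a b N" using assms by (simp add: mesh_def)
    show "(\<lambda>i j k. \<eta> i j k - \<theta> i j k) \<in> cper N" by (intro cper_pointwise[where F = "(-)"] \<eta> assms)
    show "gsum N (\<lambda>i j k. \<eta> i j k - \<theta> i j k) = 0" by (simp add: gsum_diff \<eta> assms)
    show "L_op (mesh a b N) D (\<lambda>i j k. \<eta> i j k - \<theta> i j k) = (\<lambda>i j k. 0)"
      by (intro ext) (simp add: L_op_diff \<eta> assms)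
  qed
  then show "\<eta> = \<theta>" by (simp add: fun_eq_iff)
qed

section \<open>Tangent inequalities for the energy contributions, and dissipation\<close>

lemma electrostatic_energy_diff_le:
  assumes "a < b" "N > 0" and D: "D \<in> face_per N" "face_ge D r" "r > 0"
    and \<theta>: "\<theta> \<in> cper N" "gsum N \<theta> = 0" "L_op (mesh a b N) D \<theta> = \<phi>'"
    and \<phi>: "\<phi> \<in> cper N" "gsum N \<phi> = 0"
  shows "1/2 * L_inv_norm_sq a b N D \<phi>' - 1/2 * L_inv_norm_sq a b N D \<phi>
    \<le> grid_inner (mesh a b N) N \<theta> (\<lambda>i j k. \<phi>' i j k - \<phi> i j k)"
proof -
  let ?h = "mesh a b N"
  have h: "?h > 0" using assms by (simp add: mesh_def)
  obtain \<eta> where \<eta>: "\<eta> \<in> cper N" "gsum N \<eta> = 0" "L_op ?h D \<eta> = \<phi>"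
    using L_op_surj[OF h \<open>N > 0\<close> D \<phi>] by blast
  let ?d = "\<lambda>i j k. \<theta> i j k - \<eta> i j k"
  have d: "?d \<in> cper N" by (intro cper_pointwise[where F = "(-)"] \<eta> \<theta>)
  have sym: "gsum N (\<lambda>i j k. \<theta> i j k * \<phi> i j k) = gsum N (\<lambda>i j k. \<eta> i j k * \<phi>' i j k)"
    using L_op_gsum[OF \<theta>(1) \<eta>(1) D(1), of ?h] L_op_gsum[OF \<eta>(1) \<theta>(1) D(1), of ?h]
    by (simp add: \<eta> \<theta> face_dot_grad_commute)
  have Ld: "L_op ?h D ?d i j k = \<phi>' i j k - \<phi> i j k" for i j k
    by (simp add: L_op_diff \<eta> \<theta>)
  \<comment> \<open>The energy of \<theta> - \<eta> is twice the gap in the claimed inequality, up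
    to the weight \<open>?h ^ 3\<close>; \<open>sym\<close> merges its two cross terms.\<close>
  have "0 \<le> gsum N (\<lambda>i j k. ?d i j k * L_op ?h D ?d i j k)"
    unfolding L_op_gsum[OF d d D(1)] using D by (intro gsum_nonneg face_ge_nonneg_energy) auto
  also have "\<dots> = gsum N (\<lambda>i j k. \<theta> i j k * \<phi>' i j k) - 2 * gsum N (\<lambda>i j k. \<theta> i j k * \<phi> i j k)
      + gsum N (\<lambda>i j k. \<eta> i j k * \<phi> i j k)"
    unfolding Ld using sym by (simp add: algebra_simps gsum_add gsum_diff)
  finally have "0 \<le> ?h ^ 3 * \<dots>" using h by simp
  then show ?thesis
    unfolding L_inv_norm_sq_def L_inv_eqI[OF assms(1,2) D \<theta>] L_inv_eqI[OF assms(1,2) D \<eta>] grid_inner_gsum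
    by (simp add: algebra_simps gsum_add gsum_diff)
qed

text \<open>Convexity of t (ln (v t) - 1), whose derivative is ln (v t), with the tangent taken at
  the new value \<open>y\<close>. It reduces to ln s \<le> s - 1 at s = y / x.\<close>

lemma entropy_tangent:
  fixes x y v :: real
  assumes "x > 0" "y > 0" "v > 0"
  shows "y * (ln (v * y) - 1) - x * (ln (v * x) - 1) \<le> (ln v + ln y) * (y - x)"
proof -
  have "ln (y / x) \<le> y / x - 1" using assms by (intro ln_le_minus_one) simp
  then have "x * (ln y - ln x) \<le> x * (y / x - 1)"
    using assms by (intro mult_left_mono) (simp_all add: ln_div)
  also have "\<dots> = y - x" using assms by (simp add: algebra_simps)
  finally show ?thesis using assms by (simp add: ln_mult algebra_simps)
qed

lemma inner_matrix_vector:
  fixes A :: "real ^ 'm ^ 'm"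
  shows "x \<bullet> (A *v y) = (\<Sum>m\<in>UNIV. \<Sum>n\<in>UNIV. A $ m $ n * (x $ m * y $ n))"
  by (simp add: inner_vec_def matrix_vector_mult_def sum_distrib_left mult_ac)

text \<open>The tangent of the \<open>Gc\<close> form is taken at the new point \<open>y\<close>,
  that of the \<open>Ge\<close> form at the old point \<open>x\<close>. The right side exceeds the
  left by half the sum of both forms at \<open>y - x\<close>, so the concave part also contributes
  with the good sign.\<close>

lemma steric_convex_splitting:
  fixes x y :: "real ^ 'm"
  assumes "pos_semidef Gc" "pos_semidef Ge"
  shows "1/2 * (y \<bullet> ((Gc - Ge) *v y)) - 1/2 * (x \<bullet> ((Gc - Ge) *v x))
    \<le> (y - x) \<bullet> (Gc *v y - Ge *v x)"
proof -
  have sym: "x \<bullet> (A *v y) = y \<bullet> (A *v x)" if "pos_semidef A" for A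
    using that by (metis pos_semidef_def dot_lmul_matrix inner_commute transpose_matrix_vector)
  have "0 \<le> (y - x) \<bullet> (Gc *v (y - x))" "0 \<le> (y - x) \<bullet> (Ge *v (y - x))"
    using assms by (simp_all add: pos_semidef_def)
  then show ?thesis
    using sym[OF assms(1)] sym[OF assms(2)]
    by (simp add: algebra_simps inner_diff_left inner_diff_right matrix_vector_mult_diff_distrib
        matrix_vector_mult_diff_rdistrib)
qed

lemma grad_norm_sq_gsum:
  "grad_norm_sq h N u = h ^ 3 * gsum N (face_dot (grad_h h u) (grad_h h u))"
  by (simp add: grad_norm_sq_def face_norm_sq_def grad_h_def gsum_add power2_eq_square distrib_left)
    (simp add: gsum_def)

text \<open>By summation by parts, the negative Laplacian of \<open>w\<close> is the derivative of
  half the squared gradient norm at \<open>w\<close>. The gap is half the squared gradient norm of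
  \<open>w - u\<close>.\<close>

lemma grad_energy_diff_le:
  assumes "u \<in> cper N" "w \<in> cper N" "h > 0"
  shows "1/2 * grad_norm_sq h N w - 1/2 * grad_norm_sq h N u
    \<le> grid_inner h N (\<lambda>i j k. w i j k - u i j k) (\<lambda>i j k. - laplace_h h w i j k)"
proof -
  let ?d = "\<lambda>i j k. w i j k - u i j k"
  let ?E = "\<lambda>p q. face_dot (grad_h h p) (grad_h h q)"
  have d: "?d \<in> cper N" by (intro cper_pointwise[where F = "(-)"] assms)
  have "grad_h h w \<in> face_per N" using assms by (simp add: grad_h_def face_per_def cper_differences)
  then have "gsum N (\<lambda>i j k. ?d i j k * - laplace_h h w i j k) = gsum N (?E w ?d)"
    using green_div[OF d, of "grad_h h w" h] by (simp add: laplace_h_def gsum_minus)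
  also have "?E w ?d = (\<lambda>i j k. ?E w w i j k - ?E w u i j k)"
    by (simp add: grad_h_def difference_diff fun_eq_iff algebra_simps)
  finally have L: "gsum N (\<lambda>i j k. ?d i j k * - laplace_h h w i j k) = gsum N (?E w w) - gsum N (?E w u)"
    by (simp only: gsum_diff)
  have "0 \<le> gsum N (?E ?d ?d)" by (intro gsum_nonneg) (simp add: grad_h_def)
  also have "?E ?d ?d = (\<lambda>i j k. ?E w w i j k - 2 * ?E w u i j k + ?E u u i j k)"
    by (simp add: grad_h_def difference_diff fun_eq_iff algebra_simps)
  finally have "0 \<le> gsum N (?E w w) - 2 * gsum N (?E w u) + gsum N (?E u u)"
    by (simp only: gsum_diff gsum_add gsum_cmult)
  then have "1/2 * gsum N (?E w w) - 1/2 * gsum N (?E u u) \<le> gsum N (?E w w) - gsum N (?E w u)"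
    by simp
  then have "h ^ 3 * (1/2 * gsum N (?E w w) - 1/2 * gsum N (?E u u))
      \<le> h ^ 3 * (gsum N (?E w w) - gsum N (?E w u))"
    using assms(3) by (intro mult_left_mono) auto
  then show ?thesis
    unfolding grad_norm_sq_gsum grid_inner_gsum L by (simp add: algebra_simps)
qed

text \<open>The update is -(dt * \<epsilon>) times \<open>L_op\<close> applied to \<mu>, so it has
  sum zero, and its pairing with \<mu> is minus a nonnegative energy. Positivity at the old level
  suffices, as the mobilities are averages of old values.\<close>

lemma dissipation:
  assumes "h > 0" "dt > 0" "\<epsilon> > 0" and u: "u \<in> cper N" "\<forall>i j k. u i j k > 0" and "\<mu> \<in> cper N"
    and step: "\<forall>i j k. (u' i j k - u i j k) / dt = \<epsilon> * div_grad h (face_avg u) \<mu> i j k"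
  shows "gsum N (\<lambda>i j k. u' i j k - u i j k) = 0"
    and "grid_inner h N (\<lambda>i j k. u' i j k - u i j k) \<mu> \<le> 0"
proof -
  have d: "u' i j k - u i j k = - (dt * \<epsilon>) * L_op h (face_avg u) \<mu> i j k" for i j k
    using step \<open>dt > 0\<close> by (simp add: L_op_def field_simps)
  note per = face_avg_per[OF u(1)]
  show "gsum N (\<lambda>i j k. u' i j k - u i j k) = 0"
    unfolding d gsum_cmult by (simp add: gsum_L_op assms(6) per)
  have "face_ge (face_avg u) 0"
    using u(2) by (simp add: face_avg_def Ax_def Ay_def Az_def add_nonneg_nonneg less_imp_le)
  then have "0 \<le> gsum N (\<lambda>i j k. \<mu> i j k * L_op h (face_avg u) \<mu> i j k)"
    unfolding L_op_gsum[OF assms(6,6) per] by (intro gsum_nonneg face_ge_nonneg_energy) auto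
  moreover have "gsum N (\<lambda>i j k. (u' i j k - u i j k) * \<mu> i j k)
      = - (dt * \<epsilon>) * gsum N (\<lambda>i j k. \<mu> i j k * L_op h (face_avg u) \<mu> i j k)"
    unfolding d gsum_cmult[symmetric] by (simp add: mult_ac)
  ultimately show "grid_inner h N (\<lambda>i j k. u' i j k - u i j k) \<mu> \<le> 0"
    using assms(1-3) unfolding grid_inner_gsum by (simp add: mult_nonneg_nonneg)
qed

text \<open>The tangent inequality is summed over the grid; the constant ln v multiplies the total
  mass change, which is zero.\<close>

lemma entropy_diff_le:
  assumes "h > 0" "v > 0" "\<forall>i j k. u i j k > 0" "\<forall>i j k. u' i j k > 0"
    and mass: "gsum N (\<lambda>i j k. u' i j k - u i j k) = 0"
  shows "grid_inner h N u' (\<lambda>i j k. ln (v * u' i j k) - 1) - grid_inner h N u (\<lambda>i j k. ln (v * u i j k) - 1)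
    \<le> grid_inner h N (\<lambda>i j k. u' i j k - u i j k) (\<lambda>i j k. ln (u' i j k))"
proof -
  have "gsum N (\<lambda>i j k. u' i j k * (ln (v * u' i j k) - 1)) - gsum N (\<lambda>i j k. u i j k * (ln (v * u i j k) - 1))
      \<le> gsum N (\<lambda>i j k. ln v * (u' i j k - u i j k) + (u' i j k - u i j k) * ln (u' i j k))"
    unfolding gsum_diff[symmetric]
  proof (rule gsum_mono)
    fix i j k
    have "u' i j k * (ln (v * u' i j k) - 1) - u i j k * (ln (v * u i j k) - 1)
        \<le> (ln v + ln (u' i j k)) * (u' i j k - u i j k)"
      using assms by (intro entropy_tangent) auto
    then show "u' i j k * (ln (v * u' i j k) - 1) - u i j k * (ln (v * u i j k) - 1)
        \<le> ln v * (u' i j k - u i j k) + (u' i j k - u i j k) * ln (u' i j k)"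
      by (simp add: algebra_simps)
  qed
  also have "\<dots> = gsum N (\<lambda>i j k. (u' i j k - u i j k) * ln (u' i j k))"
    unfolding gsum_add gsum_cmult mass by simp
  finally show ?thesis
    unfolding grid_inner_gsum right_diff_distrib[symmetric]
    using \<open>h > 0\<close> by (intro mult_left_mono) auto
qed

lemma steric_energy_gsum:
  fixes G :: "real ^ 'm ^ 'm"
  shows "(\<Sum>n\<in>UNIV. \<Sum>m\<in>UNIV. G $ m $ n * grid_inner h N (c m) (c n))
    = h ^ 3 * gsum N (\<lambda>i j k. (\<chi> m. c m i j k) \<bullet> (G *v (\<chi> m. c m i j k)))"
  unfolding inner_matrix_vector gsum_sum gsum_cmult grid_inner_gsum
  by (subst sum.swap) (simp add: sum_distrib_left mult_ac)

text \<open>The steric energy couples species but not grid points, so the splitting inequality is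
  applied to the vector of concentrations at each point and then summed.\<close>

lemma steric_energy_diff_le:
  fixes Gc Ge :: "real ^ 'm ^ 'm"
  assumes "h > 0" "pos_semidef Gc" "pos_semidef Ge"
  shows "1/2 * (\<Sum>n\<in>UNIV. \<Sum>m\<in>UNIV. (Gc - Ge) $ m $ n * grid_inner h N (c' m) (c' n))
      - 1/2 * (\<Sum>n\<in>UNIV. \<Sum>m\<in>UNIV. (Gc - Ge) $ m $ n * grid_inner h N (c m) (c n))
    \<le> (\<Sum>m\<in>UNIV. grid_inner h N (\<lambda>i j k. c' m i j k - c m i j k)
        (\<lambda>i j k. (\<Sum>n\<in>UNIV. Gc $ m $ n * c' n i j k) - (\<Sum>n\<in>UNIV. Ge $ m $ n * c n i j k)))"
proof -
  let ?x = "\<lambda>c i j k. \<chi> m. (c :: 'm \<Rightarrow> gridfun) m i j k"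
  let ?q = "\<lambda>c i j k. ?x c i j k \<bullet> ((Gc - Ge) *v ?x c i j k)"
  let ?R = "\<lambda>i j k. \<Sum>m\<in>UNIV. (c' m i j k - c m i j k)
        * ((\<Sum>n\<in>UNIV. Gc $ m $ n * c' n i j k) - (\<Sum>n\<in>UNIV. Ge $ m $ n * c n i j k))"
  have "1/2 * gsum N (?q c') - 1/2 * gsum N (?q c) \<le> gsum N ?R"
    unfolding gsum_cmult[symmetric] gsum_diff[symmetric]
  proof (rule gsum_mono)
    fix i j k
    have "?R i j k = (?x c' i j k - ?x c i j k) \<bullet> (Gc *v ?x c' i j k - Ge *v ?x c i j k)"
      by (simp add: inner_vec_def matrix_vector_mult_def)
    then show "1/2 * ?q c' i j k - 1/2 * ?q c i j k \<le> ?R i j k"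
      using steric_convex_splitting[OF assms(2,3), of "?x c' i j k" "?x c i j k"] by simp
  qed
  then have "h ^ 3 * (1/2 * gsum N (?q c') - 1/2 * gsum N (?q c)) \<le> h ^ 3 * gsum N ?R"
    using \<open>h > 0\<close> by (intro mult_left_mono) auto
  then show ?thesis
    unfolding steric_energy_gsum unfolding grid_inner_gsum gsum_sum sum_distrib_left[symmetric]
    by argo
qed

lemma charge_per:
  assumes "\<rho> \<in> cper N" "\<forall>m. c m \<in> cper N"
  shows "charge z \<rho> c \<in> cper N"
  using assms unfolding charge_def cper_def mem_Collect_eq
  by (intro allI arg_cong2[where f = "(+)"] sum.cong arg_cong2[where f = "(*)"] refl) auto

section \<open>Assembling the energy estimate for one time step\<close>

theorem theorem4p3:
  fixes a b v dt \<kappa>\<^sub>0 :: real and N :: nat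
    and z \<epsilon> \<sigma> :: "'m::finite \<Rightarrow> real"
    and \<kappa> :: facefun
    and G Gc Ge :: "real ^ 'm ^ 'm"
    and \<rho> \<psi> :: gridfun
    and c c' \<mu> :: "'m \<Rightarrow> gridfun"
  assumes "a < b" and "N > 0" and "v > 0" and "dt > 0"
    and "\<forall>m. \<epsilon> m > 0" and "\<forall>m. \<sigma> m > 0"
    and "\<kappa> \<in> face_per N" and "\<kappa>\<^sub>0 > 0" and "face_ge \<kappa> \<kappa>\<^sub>0"
    and "transpose G = G" and "\<forall>m n. G $ m $ n \<ge> 0"
    and "G = Gc - Ge" and "pos_semidef Gc" and "pos_semidef Ge"
    and "\<rho> \<in> cper N"
    and "\<forall>m. c m \<in> cper N" and "\<forall>m i j k. c m i j k > 0"
    and "avg a b N \<rho> + (\<Sum>m\<in>UNIV. z m * avg a b N (c m)) = 0"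
    and "scheme_step a b N dt z \<epsilon> \<sigma> \<kappa> Gc Ge \<rho> c c' \<mu> \<psi>"
  shows "free_energy a b N v z \<sigma> \<kappa> G \<rho> c' \<le> free_energy a b N v z \<sigma> \<kappa> G \<rho> c"
proof -
  let ?h = "mesh a b N"
  have h: "?h > 0" using assms(1,2) by (simp add: mesh_def)
  have c'_per: "\<forall>m. c' m \<in> cper N" and c'_pos: "\<forall>m i j k. c' m i j k > 0"
    and \<mu>_per: "\<forall>m. \<mu> m \<in> cper N" and \<psi>: "\<psi> \<in> cper N" "avg a b N \<psi> = 0"
    and step: "\<forall>m i j k. (c' m i j k - c m i j k) / dt = \<epsilon> m * div_grad ?h (face_avg (c m)) (\<mu> m) i j k"
    and \<mu>: "\<forall>m i j k. \<mu> m i j k = z m * \<psi> i j k + ln (c' m i j k)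
          + (\<Sum>n\<in>UNIV. Gc $ m $ n * c' n i j k) - \<sigma> m * laplace_h ?h (c' m) i j k
          - (\<Sum>n\<in>UNIV. Ge $ m $ n * c n i j k)"
    and poisson: "\<forall>i j k. - div_grad ?h \<kappa> \<psi> i j k = (\<Sum>m\<in>UNIV. z m * c' m i j k) + \<rho> i j k"
    using assms(19) unfolding scheme_step_def Let_def by blast+
  let ?d = "\<lambda>m i j k. c' m i j k - c m i j k"
  let ?I = "grid_inner ?h N"
  have mass: "gsum N (?d m) = 0" and diss: "?I (?d m) (\<mu> m) \<le> 0" for m
    using dissipation[OF h \<open>dt > 0\<close>, of "\<epsilon> m" "c m" N "\<mu> m" "c' m"] assms(5,16,17) \<mu>_per step by blast+
  have \<psi>0: "gsum N \<psi> = 0" using \<psi> cper0_iff[OF assms(1,2), of \<psi>] by (simp add: cper0_def)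
  have L\<psi>: "L_op ?h \<kappa> \<psi> = charge z \<rho> c'"
    using poisson by (simp add: L_op_def charge_def fun_eq_iff)
  \<comment> \<open>Charge neutrality is the compatibility condition for inverting
    \<open>L_op\<close> at the old time level, where the scheme supplies no potential. At the new
    level \<psi> itself is the mean-zero preimage, by \<open>L\<psi>\<close>.\<close>
  have "gsum N (charge z \<rho> c) = 0"
  proof -
    define A where "A = ?h ^ 3 / (b - a) ^ 3"
    have "A * gsum N (charge z \<rho> c) = 0"
      using assms(18) unfolding charge_def avg_eq_gsum gsum_add gsum_sum gsum_cmult A_def[symmetric]
      by (simp add: distrib_left sum_distrib_left mult_ac)
    then show ?thesis using h assms(1) by (simp add: A_def)
  qed
  from electrostatic_energy_diff_le[OF assms(1,2,7,9,8) \<psi>(1) \<psi>0 L\<psi> charge_per[OF assms(15,16)] this]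
  have "1/2 * L_inv_norm_sq a b N \<kappa> (charge z \<rho> c') - 1/2 * L_inv_norm_sq a b N \<kappa> (charge z \<rho> c)
      \<le> ?I \<psi> (\<lambda>i j k. charge z \<rho> c' i j k - charge z \<rho> c i j k)" .
  also have "(\<lambda>i j k. charge z \<rho> c' i j k - charge z \<rho> c i j k) = (\<lambda>i j k. \<Sum>m\<in>UNIV. z m * ?d m i j k)"
    by (simp add: charge_def right_diff_distrib sum_subtractf)
  also have "?I \<psi> \<dots> = (\<Sum>m\<in>UNIV. ?I (?d m) (\<lambda>i j k. z m * \<psi> i j k))"
    unfolding grid_inner_gsum sum_distrib_left[symmetric] gsum_sum[symmetric]
    by (simp add: sum_distrib_left mult_ac)
  finally have E1: "1/2 * L_inv_norm_sq a b N \<kappa> (charge z \<rho> c') - 1/2 * L_inv_norm_sq a b N \<kappa> (charge z \<rho> c)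
      \<le> (\<Sum>m\<in>UNIV. ?I (?d m) (\<lambda>i j k. z m * \<psi> i j k))" .
  have E2: "(\<Sum>m\<in>UNIV. ?I (c' m) (\<lambda>i j k. ln (v * c' m i j k) - 1))
      - (\<Sum>m\<in>UNIV. ?I (c m) (\<lambda>i j k. ln (v * c m i j k) - 1))
      \<le> (\<Sum>m\<in>UNIV. ?I (?d m) (\<lambda>i j k. ln (c' m i j k)))"
    unfolding sum_subtractf[symmetric]
    using assms(17) c'_pos by (intro sum_mono entropy_diff_le h \<open>v > 0\<close> mass) auto
  note E3 = steric_energy_diff_le[OF h assms(13,14), of N c' c]
  have E4: "(\<Sum>m\<in>UNIV. \<sigma> m / 2 * grad_norm_sq ?h N (c' m)) - (\<Sum>m\<in>UNIV. \<sigma> m / 2 * grad_norm_sq ?h N (c m))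
      \<le> (\<Sum>m\<in>UNIV. ?I (?d m) (\<lambda>i j k. - \<sigma> m * laplace_h ?h (c' m) i j k))"
    unfolding sum_subtractf[symmetric]
  proof (rule sum_mono)
    fix m
    have "\<sigma> m * (1/2 * grad_norm_sq ?h N (c' m) - 1/2 * grad_norm_sq ?h N (c m))
        \<le> \<sigma> m * ?I (?d m) (\<lambda>i j k. - laplace_h ?h (c' m) i j k)"
      using assms(6,16) c'_per by (intro mult_left_mono grad_energy_diff_le h) (auto simp: less_imp_le)
    also have "\<dots> = ?I (?d m) (\<lambda>i j k. - \<sigma> m * laplace_h ?h (c' m) i j k)"
      unfolding grid_inner_gsum mult.left_commute[of "\<sigma> m"] gsum_cmult[symmetric] by (simp add: mult_ac)
    finally show "\<sigma> m / 2 * grad_norm_sq ?h N (c' m) - \<sigma> m / 2 * grad_norm_sq ?h N (c m)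
        \<le> ?I (?d m) (\<lambda>i j k. - \<sigma> m * laplace_h ?h (c' m) i j k)"
      by (simp add: algebra_simps)
  qed
  \<comment> \<open>The four terms are exactly the right-hand sides of \<open>E1\<close> to
    \<open>E4\<close>, so these together bound the energy increment by the pairing of \<mu> with the
    update.\<close>
  have \<mu>_split: "?I (?d m) (\<mu> m) = ?I (?d m) (\<lambda>i j k. z m * \<psi> i j k) + ?I (?d m) (\<lambda>i j k. ln (c' m i j k))
      + ?I (?d m) (\<lambda>i j k. (\<Sum>n\<in>UNIV. Gc $ m $ n * c' n i j k) - (\<Sum>n\<in>UNIV. Ge $ m $ n * c n i j k))
      + ?I (?d m) (\<lambda>i j k. - \<sigma> m * laplace_h ?h (c' m) i j k)" for m
    unfolding grid_inner_gsum distrib_left[symmetric] gsum_add[symmetric] \<mu>[rule_format]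
    by (simp add: algebra_simps)
  have "(\<Sum>m\<in>UNIV. ?I (?d m) (\<mu> m)) \<le> 0" by (intro sum_nonpos diss)
  then show ?thesis
    using E1 E2 E3 E4 unfolding free_energy_def Let_def assms(12) \<mu>_split sum.distrib by linarith
qed

end
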